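(* Let $n$ be a positive integer, let $0<\alpha_1<1$ and $\alpha_k\ge 0$ for $2\le k\le n$ be real numbers with $\sum_{k=1}^{n}\alpha_k=1$. Let $J=[c,d]$ with $0<c<d<\infty$ and let $0<\delta\le 1\le M$. Put $$K_0:=\sum_{k=1}^{n}\alpha_k\delta^{k-1},\qquad K_1:=\sum_{k=1}^{n}\alpha_kM^{k-1},\qquad K_2:=\sum_{k=2}^{n}\alpha_k\Big(\sum_{j=0}^{k-2}M^j\Big),$$ and assume $K_2<K_0$. Let $G\in\mathcal{G}_J(K_1\delta,K_0M)$ and let $g\in\mathcal{G}_J(\delta,M)$ be the unique element of $\mathcal{G}_J(\delta,M)$ satisfying $\prod_{k=1}^{n}(g^{k}(x))^{\alpha_k}=G(x)$ for all $x\in\mathbb{R}_+$. Suppose that $G_1\in\mathcal{G}_J(K_1\delta,K_0M)$ and $g_1\in\mathcal{G}_J(\delta,M)$ satisfy $\prod_{k=1}^{n}(g_1^{k}(x))^{\alpha_k}=G_1(x)$ for all $x\in\mathbb{R}_+$. Then $$\|g-g_1\|\le\frac{d}{c(K_0-K_2)}\,\|G-G_1\|.$$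
   Context: $\mathbb{R}_+:=(0,+\infty)$. For a self-map $g$, $g^k$ denotes the $k$-th iterate ($g^0=\mathrm{id}$, $g^{k+1}=g\circ g^k$), while $(g^k(x))^{\alpha}$ denotes a real power of the number $g^k(x)$. $\mathcal{C}_b(\mathbb{R}_+)$ is the set of all bounded continuous self-maps of $\mathbb{R}_+$, and $\mathcal{R}(g)$ is the range of $g$. For functions on $\mathbb{R}_+$, $\|h\|:=\sup\{|h(x)|:x\in\mathbb{R}_+\}$. For a compact interval $J=[c,d]\subset\mathbb{R}_+$ with $c<d$ and for real numbers $\delta,M\ge 0$, $$\mathcal{G}_J(\delta,M):=\Big\{g\in\mathcal{C}_b(\mathbb{R}_+):\ \mathcal{R}(g)=J,\ g(c)=c,\ g(d)=d,\ \Big(\tfrac{x}{y}\Big)^{\delta}\le\tfrac{g(x)}{g(y)}\le\Big(\tfrac{x}{y}\Big)^{M}\ \forall x,y\in J\text{ with }x\ge y\Big\}.$$ Under the stated hypotheses the solution $g\in\mathcal{G}_J(\delta,M)$ of the equation for $G$ exists and is unique. *)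

theory Defs
  imports "HOL-Analysis.Analysis"
begin

abbreviation Rpos :: "real set"  ("\<real>\<^sub>+")
  where "\<real>\<^sub>+ \<equiv> {0<..}"

(* Self-maps of the positive reals are total functions on the reals, of which only the values on the
   positive reals matter: nothing below depends on the values at nonpositive arguments. *)

definition Cb_pos :: "(real \<Rightarrow> real) set" where
  "Cb_pos = {g. g \<in> \<real>\<^sub>+ \<rightarrow> \<real>\<^sub>+ \<and> continuous_on \<real>\<^sub>+ g \<and> bounded (g ` \<real>\<^sub>+)}"

definition G_class :: "real \<Rightarrow> real \<Rightarrow> real \<Rightarrow> real \<Rightarrow> (real \<Rightarrow> real) set" where
  "G_class c d \<delta> M = {g \<in> Cb_pos. g ` \<real>\<^sub>+ = {c..d} \<and> g c = c \<and> g d = d \<and>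
     (\<forall>x\<in>{c..d}. \<forall>y\<in>{c..d}. x \<ge> y \<longrightarrow>
        (x / y) powr \<delta> \<le> g x / g y \<and> g x / g y \<le> (x / y) powr M)}"

(* The supremum is taken in the reals, so it is meaningful for functions bounded on the positive
   reals, such as differences of members of Cb_pos. *)

definition sup_norm_pos :: "(real \<Rightarrow> real) \<Rightarrow> real" where
  "sup_norm_pos h = (SUP x\<in>\<real>\<^sub>+. \<bar>h x\<bar>)"

end

theory Submission
  imports Defs
begin

text \<open>
  In logarithmic coordinates, the members of the class G(delta, M) are bi-Lipschitz increasing maps
  of the interval, and the equation reads \<open>\<Phi>\<^sub>g (g x) = ln (G x)\<close> with
  \<open>\<Phi>\<^sub>g y = (\<Sum>k. \<alpha> k * ln (g\<^sup>k\<^sup>-\<^sup>1 y))\<close>. The map \<open>\<Phi>\<^sub>g\<close> expands logarithmic distances by at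
  least \<open>K0\<close>, while \<open>\<Phi>\<^sub>g\<close> and \<open>\<Phi>\<^sub>g\<^sub>1\<close> differ by at most \<open>K2 * D\<close>, where \<open>D\<close> is the supremum
  of \<open>\<bar>ln (g x) - ln (g1 x)\<bar>\<close>. Hence \<open>(K0 - K2) * D\<close> is at most the logarithmic distance of \<open>G\<close>
  and \<open>G1\<close>; the factor \<open>d / c\<close> is the cost of passing to logarithms and back on \<open>[c, d]\<close>.
\<close>

text \<open>The slope of \<open>ln\<close> is at most \<open>1 / c\<close> to the right of
  \<open>c\<close>. This accounts for the factor \<open>1 / c\<close> in the final constant: it is
  applied to the values of \<open>G\<close> and \<open>G1\<close>.\<close>

lemma abs_ln_diff_le:
  fixes a b c :: real
  assumes "0 < c" "c \<le> a" "c \<le> b"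
  shows "\<bar>ln a - ln b\<bar> \<le> \<bar>a - b\<bar> / c"
proof -
  have *: "ln a - ln b \<le> \<bar>a - b\<bar> / c" if "c \<le> a" "c \<le> b" for a b
  proof -
    have "ln a - ln b \<le> (a - b) / b"
      using that assms(1) by (intro ln_diff_le) auto
    also have "\<dots> \<le> \<bar>a - b\<bar> / c"
      using that assms(1) by (intro frac_le) auto
    finally show ?thesis .
  qed
  show ?thesis
    using *[of a b] *[of b a] assms by (simp add: abs_le_iff abs_minus_commute)
qed

text \<open>The slope of \<open>ln\<close> is at least \<open>1 / d\<close> on the positive numbers
  up to \<open>d\<close>. Applied to the values of \<open>g\<close> and \<open>g1\<close>, this
  gives the factor \<open>d\<close>.\<close>

lemma abs_diff_le_ln:
  fixes a b d :: real
  assumes "0 < a" "a \<le> d" "0 < b" "b \<le> d"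
  shows "\<bar>a - b\<bar> \<le> d * \<bar>ln a - ln b\<bar>"
proof -
  have *: "a - b \<le> d * \<bar>ln a - ln b\<bar>" if "0 < a" "a \<le> d" "0 < b" for a b
  proof -
    \<comment> \<open>The tangent estimate is taken at \<open>a\<close> with the roles exchanged, so
      that the factor after clearing the denominator is \<open>a\<close>, which is at most
      \<open>d\<close>.\<close>
    have "ln b - ln a \<le> (b - a) / a"
      using that by (intro ln_diff_le) auto
    then have "a - b \<le> a * (ln a - ln b)"
      using that by (simp add: field_simps)
    also have "\<dots> \<le> a * \<bar>ln a - ln b\<bar>"
      using that by (intro mult_left_mono) auto
    also have "\<dots> \<le> d * \<bar>ln a - ln b\<bar>"
      using that by (intro mult_right_mono) auto
    finally show ?thesis .
  qed
  show ?thesis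
    using *[of a b] *[of b a] assms by (simp add: abs_le_iff abs_minus_commute)
qed

lemma G_class_range:
  assumes "g \<in> G_class c d \<delta> M" "0 < x"
  shows "g x \<in> {c..d}"
  using assms unfolding G_class_def by (auto simp: set_eq_iff)

lemma G_class_funpow_range:
  assumes "g \<in> G_class c d \<delta> M" "0 < c" "x \<in> {c..d}"
  shows "(g ^^ m) x \<in> {c..d}"
proof (induction m)
  case (Suc m)
  then show ?case
    using G_class_range[OF assms(1), of "(g ^^ m) x"] assms(2) by simp
qed (use assms in simp)

lemma G_class_ln:
  assumes g: "g \<in> G_class c d \<delta> M" and "0 < c" and x: "x \<in> {c..d}" and y: "y \<in> {c..d}" and "y \<le> x"
  shows "\<delta> * (ln x - ln y) \<le> ln (g x) - ln (g y)"
    and "ln (g x) - ln (g y) \<le> M * (ln x - ln y)"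
proof -
  have pos: "0 < x" "0 < y" using x y \<open>0 < c\<close> by auto
  then have gpos: "0 < g x" "0 < g y"
    using G_class_range[OF g] \<open>0 < c\<close> by force+
  have bounds: "(x / y) powr \<delta> \<le> g x / g y" "g x / g y \<le> (x / y) powr M"
    using g x y \<open>y \<le> x\<close> unfolding G_class_def by auto
  have "ln ((x / y) powr \<delta>) \<le> ln (g x / g y)" "ln (g x / g y) \<le> ln ((x / y) powr M)"
    using bounds pos gpos by (subst ln_le_cancel_iff; simp)+
  then show "\<delta> * (ln x - ln y) \<le> ln (g x) - ln (g y)" "ln (g x) - ln (g y) \<le> M * (ln x - ln y)"
    using pos gpos by (simp_all add: ln_powr ln_div)
qed

lemma G_class_abs_ln_le:
  assumes "g \<in> G_class c d \<delta> M" "0 < c" "x \<in> {c..d}" "y \<in> {c..d}" "0 \<le> \<delta>"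
  shows "\<bar>ln (g x) - ln (g y)\<bar> \<le> M * \<bar>ln x - ln y\<bar>"
proof -
  have *: "\<bar>ln (g x) - ln (g y)\<bar> \<le> M * \<bar>ln x - ln y\<bar>"
    if "y \<le> x" "x \<in> {c..d}" "y \<in> {c..d}" for x y
  proof -
    have "ln y \<le> ln x" using that assms(2) by auto
    moreover from this have "0 \<le> \<delta> * (ln x - ln y)" using assms(5) by simp
    ultimately show ?thesis
      using G_class_ln[OF assms(1,2) that(2,3,1)] by linarith
  qed
  show ?thesis
    using *[of y x] *[of x y] assms(3,4) by (cases "y \<le> x") (auto simp: abs_minus_commute)
qed

lemma G_class_funpow_ln_ge:
  assumes g: "g \<in> G_class c d \<delta> M" and c: "0 < c" and \<delta>: "0 \<le> \<delta>"
    and x: "x \<in> {c..d}" and y: "y \<in> {c..d}" and "y \<le> x"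
  shows "\<delta> ^ m * (ln x - ln y) \<le> ln ((g ^^ m) x) - ln ((g ^^ m) y)"
proof (induction m)
  case (Suc m)
  let ?x = "(g ^^ m) x" and ?y = "(g ^^ m) y"
  have range: "?x \<in> {c..d}" "?y \<in> {c..d}"
    using G_class_funpow_range[OF g c] x y by blast+
  \<comment> \<open>The class bounds hold only for ordered pairs. The induction hypothesis itself
    shows that the m-th iterates are still in order.\<close>
  have "0 \<le> \<delta> ^ m * (ln x - ln y)"
    using x y c \<delta> \<open>y \<le> x\<close> by (intro mult_nonneg_nonneg) auto
  with Suc have "ln ?y \<le> ln ?x" by linarith
  then have "?y \<le> ?x"
    using range c by (subst (asm) ln_le_cancel_iff) auto
  have "\<delta> ^ Suc m * (ln x - ln y) = \<delta> * (\<delta> ^ m * (ln x - ln y))" by simp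
  also have "\<dots> \<le> \<delta> * (ln ?x - ln ?y)"
    by (rule mult_left_mono[OF Suc \<delta>])
  also have "\<dots> \<le> ln (g ?x) - ln (g ?y)"
    by (rule G_class_ln(1)[OF g c range \<open>?y \<le> ?x\<close>])
  finally show ?case by simp
qed simp

text \<open>Inserting \<open>g ((h ^^ m) y)\<close> between the next iterates splits their distance
  in two: the old error, magnified by at most \<open>M\<close>, and one new error of at most
  \<open>D\<close>. The recursion s \<mapsto> M s + 1 started at 0 produces the geometric
  sum.\<close>

lemma G_class_funpow_ln_dist:
  assumes g: "g \<in> G_class c d \<delta> M" and h: "h \<in> G_class c d \<delta> M"
    and c: "0 < c" and \<delta>: "0 \<le> \<delta>" and M: "0 \<le> M" and y: "y \<in> {c..d}"
    and D: "\<And>x. 0 < x \<Longrightarrow> \<bar>ln (g x) - ln (h x)\<bar> \<le> D"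
  shows "\<bar>ln ((g ^^ m) y) - ln ((h ^^ m) y)\<bar> \<le> (\<Sum>j<m. M ^ j) * D"
proof (induction m)
  case (Suc m)
  let ?x = "(g ^^ m) y" and ?y = "(h ^^ m) y"
  have range: "?x \<in> {c..d}" "?y \<in> {c..d}"
    using G_class_funpow_range[OF g c y] G_class_funpow_range[OF h c y] by blast+
  have "\<bar>ln (g ?x) - ln (g ?y)\<bar> \<le> M * \<bar>ln ?x - ln ?y\<bar>"
    by (rule G_class_abs_ln_le[OF g c range \<delta>])
  also have "\<dots> \<le> M * ((\<Sum>j<m. M ^ j) * D)"
    by (rule mult_left_mono[OF Suc M])
  finally have "\<bar>ln (g ?x) - ln (g ?y)\<bar> \<le> M * ((\<Sum>j<m. M ^ j) * D)" .
  moreover have "\<bar>ln (g ?y) - ln (h ?y)\<bar> \<le> D"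
    using D range c by auto
  ultimately have "\<bar>ln (g ?x) - ln (h ?y)\<bar> \<le> M * ((\<Sum>j<m. M ^ j) * D) + D"
    by linarith
  also have "\<dots> = (\<Sum>j<Suc m. M ^ j) * D"
    by (simp add: sum.lessThan_Suc_shift sum_distrib_left algebra_simps del: sum.lessThan_Suc)
  finally show ?case by simp
qed simp

lemma bdd_above_abs_diff_G_class:
  assumes "g \<in> G_class c d \<delta> M" "h \<in> G_class c d \<delta>' M'"
  shows "bdd_above ((\<lambda>x. \<bar>g x - h x\<bar>) ` \<real>\<^sub>+)"
proof (rule bdd_aboveI2)
  fix x :: real assume "x \<in> \<real>\<^sub>+"
  then show "\<bar>g x - h x\<bar> \<le> d - c"
    using G_class_range[OF assms(1), of x] G_class_range[OF assms(2), of x] by auto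
qed

text \<open>One application of \<open>g\<close> is split off because \<open>x\<close> may lie
  outside \<open>{c..d}\<close>, where the class gives no power bounds, whereas \<open>g x\<close>
  always lies inside. This lowers the iteration exponents to \<open>k - 1\<close>.\<close>

lemma ln_iterative_equation:
  assumes g: "g \<in> G_class c d \<delta> M" and c: "0 < c" and x: "0 < x"
    and eq: "(\<Prod>k=1..n. ((g ^^ k) x) powr \<alpha> k) = G x"
  shows "(\<Sum>k=1..n. \<alpha> k * ln ((g ^^ (k - 1)) (g x))) = ln (G x)"
proof -
  have shift: "(g ^^ (k - 1)) (g x) = (g ^^ k) x" if "k \<in> {1..n}" for k
    using that by (cases k) (simp_all add: funpow_swap1)
  have pos: "0 < (g ^^ k) x" if "k \<in> {1..n}" for k
    using G_class_funpow_range[OF g c G_class_range[OF g x], of "k - 1"] shift[OF that] c by simp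
  have "ln (G x) = (\<Sum>k=1..n. ln (((g ^^ k) x) powr \<alpha> k))"
    unfolding eq[symmetric] by (rule ln_prod) (use pos in force)+
  also have "\<dots> = (\<Sum>k=1..n. \<alpha> k * ln ((g ^^ (k - 1)) (g x)))"
    using pos shift by (intro sum.cong) (auto simp: ln_powr)
  finally show ?thesis ..
qed

text \<open>All iterates of \<open>g\<close> preserve order and the weights are nonnegative, so the
  summands of the difference share one sign. Nothing cancels, and the lower bounds add up.\<close>

lemma weighted_funpow_ln_ge:
  assumes g: "g \<in> G_class c d \<delta> M" and c: "0 < c" and \<delta>: "0 \<le> \<delta>"
    and \<alpha>: "\<And>k. k \<in> {1..n} \<Longrightarrow> 0 \<le> \<alpha> k"
    and x: "x \<in> {c..d}" and y: "y \<in> {c..d}"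
  shows "(\<Sum>k=1..n. \<alpha> k * \<delta> ^ (k - 1)) * \<bar>ln x - ln y\<bar>
    \<le> \<bar>(\<Sum>k=1..n. \<alpha> k * ln ((g ^^ (k - 1)) x)) - (\<Sum>k=1..n. \<alpha> k * ln ((g ^^ (k - 1)) y))\<bar>"
    (is "?K * _ \<le> \<bar>?\<Phi> x - ?\<Phi> y\<bar>")
proof -
  have *: "?K * \<bar>ln x - ln y\<bar> \<le> \<bar>?\<Phi> x - ?\<Phi> y\<bar>"
    if "y \<le> x" "x \<in> {c..d}" "y \<in> {c..d}" for x y
  proof -
    have "ln y \<le> ln x" using that c by auto
    then have "?K * \<bar>ln x - ln y\<bar> = (\<Sum>k=1..n. \<alpha> k * (\<delta> ^ (k - 1) * (ln x - ln y)))"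
      by (simp add: sum_distrib_right mult.assoc)
    also have "\<dots> \<le> (\<Sum>k=1..n. \<alpha> k * (ln ((g ^^ (k - 1)) x) - ln ((g ^^ (k - 1)) y)))"
      using \<alpha> G_class_funpow_ln_ge[OF g c \<delta> that(2,3,1)] by (intro sum_mono mult_left_mono) auto
    also have "\<dots> = ?\<Phi> x - ?\<Phi> y"
      by (simp add: right_diff_distrib sum_subtractf)
    finally show ?thesis by linarith
  qed
  show ?thesis
    using *[of y x] *[of x y] x y by (cases "y \<le> x") (auto simp: abs_minus_commute)
qed

lemma weighted_funpow_ln_dist:
  assumes g: "g \<in> G_class c d \<delta> M" and h: "h \<in> G_class c d \<delta> M"
    and c: "0 < c" and \<delta>: "0 \<le> \<delta>" and M: "0 \<le> M" and y: "y \<in> {c..d}"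
    and \<alpha>: "\<And>k. k \<in> {1..n} \<Longrightarrow> 0 \<le> \<alpha> k"
    and D: "\<And>x. 0 < x \<Longrightarrow> \<bar>ln (g x) - ln (h x)\<bar> \<le> D"
  shows "\<bar>(\<Sum>k=1..n. \<alpha> k * ln ((g ^^ (k - 1)) y)) - (\<Sum>k=1..n. \<alpha> k * ln ((h ^^ (k - 1)) y))\<bar>
    \<le> (\<Sum>k=1..n. \<alpha> k * (\<Sum>j<k - 1. M ^ j)) * D"
proof -
  have "\<bar>(\<Sum>k=1..n. \<alpha> k * ln ((g ^^ (k - 1)) y)) - (\<Sum>k=1..n. \<alpha> k * ln ((h ^^ (k - 1)) y))\<bar>
    = \<bar>\<Sum>k=1..n. \<alpha> k * (ln ((g ^^ (k - 1)) y) - ln ((h ^^ (k - 1)) y))\<bar>"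
    by (simp add: right_diff_distrib sum_subtractf)
  also have "\<dots> \<le> (\<Sum>k=1..n. \<bar>\<alpha> k * (ln ((g ^^ (k - 1)) y) - ln ((h ^^ (k - 1)) y))\<bar>)"
    by (rule sum_abs)
  also have "\<dots> \<le> (\<Sum>k=1..n. \<alpha> k * ((\<Sum>j<k - 1. M ^ j) * D))"
  proof (rule sum_mono)
    fix k assume "k \<in> {1..n}"
    then have "0 \<le> \<alpha> k" by (rule \<alpha>)
    then show "\<bar>\<alpha> k * (ln ((g ^^ (k - 1)) y) - ln ((h ^^ (k - 1)) y))\<bar> \<le> \<alpha> k * ((\<Sum>j<k - 1. M ^ j) * D)"
      unfolding abs_mult using G_class_funpow_ln_dist[OF g h c \<delta> M y D]
      by (simp add: mult_left_mono)
  qed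
  finally show ?thesis
    by (simp add: sum_distrib_right mult.assoc)
qed

theorem theorem2:
  fixes n :: nat and \<alpha> :: "nat \<Rightarrow> real"
    and c d \<delta> M K0 K1 K2 :: real
    and G g G1 g1 :: "real \<Rightarrow> real"
  assumes "n \<ge> 1"
    and "0 < \<alpha> 1" and "\<alpha> 1 < 1"
    and "\<forall>k\<in>{2..n}. \<alpha> k \<ge> 0"
    and "(\<Sum>k=1..n. \<alpha> k) = 1"
    and "0 < c" and "c < d"
    and "0 < \<delta>" and "\<delta> \<le> 1" and "1 \<le> M"
    and "K0 = (\<Sum>k=1..n. \<alpha> k * \<delta> ^ (k - 1))"
    and "K1 = (\<Sum>k=1..n. \<alpha> k * M ^ (k - 1))"
    and "K2 = (\<Sum>k=2..n. \<alpha> k * (\<Sum>j=0..k - 2. M ^ j))"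
    and "K2 < K0"
    and "G \<in> G_class c d (K1 * \<delta>) (K0 * M)"
    and "g \<in> G_class c d \<delta> M"
    and "\<forall>x\<in>\<real>\<^sub>+. (\<Prod>k=1..n. ((g ^^ k) x) powr \<alpha> k) = G x"
    and "G1 \<in> G_class c d (K1 * \<delta>) (K0 * M)"
    and "g1 \<in> G_class c d \<delta> M"
    and "\<forall>x\<in>\<real>\<^sub>+. (\<Prod>k=1..n. ((g1 ^^ k) x) powr \<alpha> k) = G1 x"
  shows "sup_norm_pos (\<lambda>x. g x - g1 x) \<le> d / (c * (K0 - K2)) * sup_norm_pos (\<lambda>x. G x - G1 x)"
proof -
  note g = \<open>g \<in> G_class c d \<delta> M\<close> and g1 = \<open>g1 \<in> G_class c d \<delta> M\<close>
  note G = \<open>G \<in> G_class c d (K1 * \<delta>) (K0 * M)\<close> and G1 = \<open>G1 \<in> G_class c d (K1 * \<delta>) (K0 * M)\<close>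
  note c = \<open>0 < c\<close> and eqs = assms(17,20)
  have \<delta>: "0 \<le> \<delta>" and M: "0 \<le> M" and gap: "0 < K0 - K2" and d: "0 < d"
    using assms by auto
  have \<alpha>: "0 \<le> \<alpha> k" if "k \<in> {1..n}" for k
    using that \<open>0 < \<alpha> 1\<close> \<open>\<forall>k\<in>{2..n}. \<alpha> k \<ge> 0\<close> by (cases "k = 1") auto
  \<comment> \<open>The term for \<open>k = 1\<close> carries an empty inner sum, so the outer sum
    can start at 1, as in \<open>weighted_funpow_ln_dist\<close>.\<close>
  have K2_eq: "K2 = (\<Sum>k=1..n. \<alpha> k * (\<Sum>j<k - 1. M ^ j))"
  proof -
    have "(\<Sum>k=1..n. \<alpha> k * (\<Sum>j<k - 1. M ^ j)) = (\<Sum>k=2..n. \<alpha> k * (\<Sum>j<k - 1. M ^ j))"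
      by (rule sum.mono_neutral_right) (auto simp: not_le)
    also have "\<dots> = K2"
      unfolding \<open>K2 = _\<close>
    proof (intro sum.cong arg_cong2[where f = "(*)"] refl)
      \<comment> \<open>This needs \<open>k\<close> \<ge> 2: for \<open>k = 1\<close>, truncated
        subtraction would make \<open>{0..k - 2}\<close> a singleton.\<close>
      fix k assume "k \<in> {2..n}"
      then show "{..<k - 1} = {0..k - 2}" by auto
    qed
    finally show ?thesis ..
  qed
  \<comment> \<open>Together with \<open>K2 < K0\<close> this makes \<open>K0\<close> positive,
    which the division by \<open>K0\<close> below requires.\<close>
  have "0 \<le> K2"
    unfolding K2_eq using \<alpha> M by (intro sum_nonneg mult_nonneg_nonneg) auto
  define D where "D = (SUP x\<in>\<real>\<^sub>+. \<bar>ln (g x) - ln (g1 x)\<bar>)"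
  define N where "N = sup_norm_pos (\<lambda>x. G x - G1 x)"
  have N: "\<bar>G x - G1 x\<bar> \<le> N" if "0 < x" for x
    unfolding N_def sup_norm_pos_def
    using that bdd_above_abs_diff_G_class[OF G G1] by (intro cSUP_upper) auto
  \<comment> \<open>Without boundedness the real supremum \<open>D\<close> need not be an upper
    bound.\<close>
  have "bdd_above ((\<lambda>x. \<bar>ln (g x) - ln (g1 x)\<bar>) ` \<real>\<^sub>+)"
  proof (rule bdd_aboveI2)
    fix x :: real assume "x \<in> \<real>\<^sub>+"
    then have "ln c \<le> ln (g x)" "ln (g x) \<le> ln d" "ln c \<le> ln (g1 x)" "ln (g1 x) \<le> ln d"
      using G_class_range[OF g, of x] G_class_range[OF g1, of x] c by auto
    then show "\<bar>ln (g x) - ln (g1 x)\<bar> \<le> ln d - ln c" by linarith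
  qed
  then have D: "\<bar>ln (g x) - ln (g1 x)\<bar> \<le> D" if "0 < x" for x
    unfolding D_def using that by (intro cSUP_upper) auto
  \<comment> \<open>The pivot is \<open>?\<Phi> g (g1 x)\<close>. Moving its argument to
    \<open>g x\<close> is controlled from below by \<open>K0\<close>, and exchanging
    \<open>g\<close> for \<open>g1\<close> costs at most \<open>K2 * D\<close>. The two outer values
    are \<open>ln (G x)\<close> and \<open>ln (G1 x)\<close> by the equations.\<close>
  have "\<bar>ln (g x) - ln (g1 x)\<bar> \<le> (N / c + K2 * D) / K0" if "x \<in> \<real>\<^sub>+" for x
  proof -
    let ?\<Phi> = "\<lambda>g y. \<Sum>k=1..n. \<alpha> k * ln ((g ^^ (k - 1)) y)"
    have x: "0 < x" using that by simp
    have "K0 * \<bar>ln (g x) - ln (g1 x)\<bar> \<le> \<bar>?\<Phi> g (g x) - ?\<Phi> g (g1 x)\<bar>"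
      unfolding \<open>K0 = _\<close>
      by (rule weighted_funpow_ln_ge[OF g c \<delta> \<alpha> G_class_range[OF g x] G_class_range[OF g1 x]])
    moreover have "\<bar>?\<Phi> g (g1 x) - ?\<Phi> g1 (g1 x)\<bar> \<le> K2 * D"
      unfolding K2_eq
      by (rule weighted_funpow_ln_dist[OF g g1 c \<delta> M G_class_range[OF g1 x] \<alpha> D])
    moreover have "?\<Phi> g (g x) = ln (G x)" "?\<Phi> g1 (g1 x) = ln (G1 x)"
      using ln_iterative_equation[OF g c x] ln_iterative_equation[OF g1 c x] eqs that by blast+
    moreover have "\<bar>ln (G x) - ln (G1 x)\<bar> \<le> \<bar>G x - G1 x\<bar> / c"
      using G_class_range[OF G x] G_class_range[OF G1 x] c by (intro abs_ln_diff_le) auto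
    moreover have "\<bar>G x - G1 x\<bar> / c \<le> N / c"
      using N[OF x] c by (simp add: divide_right_mono)
    ultimately have "K0 * \<bar>ln (g x) - ln (g1 x)\<bar> \<le> N / c + K2 * D" by linarith
    then show ?thesis
      using \<open>0 \<le> K2\<close> gap by (simp add: pos_le_divide_eq mult.commute)
  qed
  \<comment> \<open>The bound is uniform in \<open>x\<close>, so it passes to the supremum.
    \<open>D\<close> then occurs on both sides, and \<open>K2 < K0\<close> lets the right-hand
    occurrence be absorbed.\<close>
  then have "D \<le> (N / c + K2 * D) / K0"
    unfolding D_def by (intro cSUP_least) auto
  then have "(K0 - K2) * D \<le> N / c"
    using \<open>0 \<le> K2\<close> gap by (simp add: pos_le_divide_eq algebra_simps)
  then have D_le: "D \<le> N / (c * (K0 - K2))"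
    using gap c by (simp add: field_simps)
  show ?thesis
    unfolding sup_norm_pos_def[of "\<lambda>x. g x - g1 x"] N_def[symmetric]
  proof (rule cSUP_least)
    fix x :: real assume "x \<in> \<real>\<^sub>+"
    then have x: "0 < x" by simp
    have "\<bar>g x - g1 x\<bar> \<le> d * \<bar>ln (g x) - ln (g1 x)\<bar>"
      using G_class_range[OF g x] G_class_range[OF g1 x] c by (intro abs_diff_le_ln) auto
    also have "\<dots> \<le> d * (N / (c * (K0 - K2)))"
      using D[OF x] D_le d by (intro mult_left_mono) auto
    finally show "\<bar>g x - g1 x\<bar> \<le> d / (c * (K0 - K2)) * N" by simp
  qed simp
qed

end
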